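(* Let $N$ be an odd prime, $\zeta=e^{2\pi i/N}$, $O=\mathbb{Z}[\zeta]$, and let $\beta\in O$ be binary. Then $$\mathcal{N}(\beta)\le\left(\frac{N+1}{4}\right)^{\frac{N-1}{2}},$$ and equality holds only if $\beta$ is perfect.
   Context: Elements of $O$ are written in the basis $\zeta,\dots,\zeta^{N-1}$ as $\alpha=\sum_{i=1}^{N-1}[\alpha]_i\zeta^i$. An element $\beta\in O$ is binary if $\beta\neq0$ and either all coordinates $[\beta]_i$ lie in $\{0,1\}$ or all lie in $\{-1,0\}$. For $1\le j\le N-1$, $\sigma_j$ is the automorphism of $O$ with $\sigma_j(\zeta)=\zeta^j$. The norm is $\mathcal{N}(\alpha)=\prod_{j=1}^{N-1}\sigma_j(\alpha)=\prod_{j=1}^{(N-1)/2}|\sigma_j(\alpha)|^2\in\mathbb{Z}$. A binary $\beta\in O$ is perfect if $\beta\overline{\beta}\in\mathbb{Z}$, where the overbar is complex conjugation ($\zeta\mapsto\zeta^{-1}$). *)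

theory Defs
  imports
    "HOL-Analysis.Analysis"
    "HOL-Computational_Algebra.Computational_Algebra"
    "HOL-Number_Theory.Cong"
    "HOL-Algebra.QuotRing"
begin

definition zeta :: "nat \<Rightarrow> complex" where
  "zeta N = exp (2 * of_real pi * \<i> / of_nat N)"

definition cyc_int :: "nat \<Rightarrow> complex set" where
  "cyc_int N = range (\<lambda>p :: int poly. poly (map_poly of_int p) (zeta N))"

definition cyc_ring :: "nat \<Rightarrow> complex ring" where
  "cyc_ring N = \<lparr>carrier = cyc_int N, mult = (*), one = 1, zero = 0, add = (+)\<rparr>"

definition is_cyc_coord :: "nat \<Rightarrow> complex \<Rightarrow> (nat \<Rightarrow> int) \<Rightarrow> bool" where
  "is_cyc_coord N \<alpha> c \<longleftrightarrow>
     (\<forall>i. i \<notin> {1..N-1} \<longrightarrow> c i = 0) \<and> \<alpha> = (\<Sum>i=1..N-1. of_int (c i) * zeta N ^ i)"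

text \<open>\<open>cyc_coord N \<alpha> i\<close> is the coordinate of \<open>\<alpha>\<close> at \<open>\<zeta>\<^sup>i\<close> in the basis
  \<open>\<zeta>, \<dots>, \<zeta>\<^bsup>N-1\<^esup>\<close> (which does not contain \<open>1\<close>).\<close>

definition cyc_coord :: "nat \<Rightarrow> complex \<Rightarrow> nat \<Rightarrow> int" where
  "cyc_coord N \<alpha> = (THE c. is_cyc_coord N \<alpha> c)"

definition cyc_binary :: "nat \<Rightarrow> complex \<Rightarrow> bool" where
  "cyc_binary N \<beta> \<longleftrightarrow> \<beta> \<in> cyc_int N \<and> \<beta> \<noteq> 0 \<and>
     ((\<forall>i\<in>{1..N-1}. cyc_coord N \<beta> i \<in> {0, 1}) \<or> (\<forall>i\<in>{1..N-1}. cyc_coord N \<beta> i \<in> {-1, 0}))"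

text \<open>Membership in \<^const>\<open>extensional\<close> only fixes the irrelevant values outside
  \<open>\<int>[\<zeta>]\<close>, so that the automorphism is unique as a HOL function.\<close>

definition is_cyc_sigma :: "nat \<Rightarrow> nat \<Rightarrow> (complex \<Rightarrow> complex) \<Rightarrow> bool" where
  "is_cyc_sigma N j \<sigma> \<longleftrightarrow>
     \<sigma> \<in> ring_iso (cyc_ring N) (cyc_ring N) \<and> \<sigma> \<in> extensional (cyc_int N) \<and> \<sigma> (zeta N) = zeta N ^ j"

definition cyc_sigma :: "nat \<Rightarrow> nat \<Rightarrow> complex \<Rightarrow> complex" where
  "cyc_sigma N j = (THE \<sigma>. is_cyc_sigma N j \<sigma>)"

definition cyc_norm :: "nat \<Rightarrow> complex \<Rightarrow> int" where
  "cyc_norm N \<alpha> = (THE n. of_int n = (\<Prod>j=1..N-1. cyc_sigma N j \<alpha>))"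

definition cyc_perfect :: "nat \<Rightarrow> complex \<Rightarrow> bool" where
  "cyc_perfect N \<beta> \<longleftrightarrow> cyc_binary N \<beta> \<and> \<beta> * cnj \<beta> \<in> \<int>"

text \<open>
  The remainder shows that the definite descriptions in \<^const>\<open>cyc_coord\<close>,
  \<^const>\<open>cyc_sigma\<close> and \<^const>\<open>cyc_norm\<close> are well defined for prime \<open>N\<close>: see
  \<open>is_cyc_coord_ex1\<close>, \<open>is_cyc_sigma_ex1\<close> and \<open>of_int_cyc_norm\<close>. This rests on the
  irreducibility of the cyclotomic polynomial (Eisenstein).
\<close>

abbreviation (input) ev :: "int poly \<Rightarrow> complex \<Rightarrow> complex" where
  "ev f z \<equiv> poly (map_poly of_int f) z"

lemma ev_add: "ev (f + g) z = ev f z + ev g z"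
proof -
  have "map_poly of_int (f + g) = (map_poly of_int f + map_poly of_int g :: complex poly)"
    by (rule poly_eqI) (simp add: coeff_map_poly)
  thus ?thesis by simp
qed

lemma ev_mult: "ev (f * g) z = ev f z * ev g z"
proof -
  have "map_poly of_int (f * g) = (map_poly of_int f * map_poly of_int g :: complex poly)"
    by (rule poly_eqI) (simp add: coeff_map_poly coeff_mult)
  thus ?thesis by simp
qed

lemma ev_monom: "ev (monom c n) z = of_int c * z ^ n"
  by (simp add: map_poly_monom poly_monom)

lemma ev_const: "ev [:c:] z = of_int c"
  by (simp add: map_poly_pCons)

lemma ev_1: "ev 1 z = 1"
  using ev_const[of 1 z] by (simp flip: one_pCons)

lemma ev_smult: "ev (smult c f) z = of_int c * ev f z"
  using ev_mult[of "[:c:]" f z] by (simp add: ev_const)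

lemma ev_diff: "ev (f - g) z = ev f z - ev g z"
  using ev_add[of "f - g" g z] by simp

lemma ev_prod: "ev (\<Prod>j\<in>A. f j) z = (\<Prod>j\<in>A. ev (f j) z)"
  by (induction A rule: infinite_finite_induct) (simp_all add: ev_1 ev_mult)

lemma ev_sum: "ev (\<Sum>j\<in>A. f j) z = (\<Sum>j\<in>A. ev (f j) z)"
  by (induction A rule: infinite_finite_induct) (simp_all add: ev_add)

lemma ev_pcompose: "ev (pcompose f g) z = ev f (ev g z)"
  by (induction f) (simp_all add: pcompose_pCons ev_add ev_mult map_poly_pCons)

lemma ev_altdef: "ev f z = (\<Sum>i\<le>degree f. of_int (coeff f i) * z ^ i)"
  by (simp add: poly_altdef coeff_map_poly degree_map_poly)

lemma zeta_power: "zeta N ^ j = exp (2 * of_real pi * \<i> * of_nat j / of_nat N)"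
proof -
  have "2 * of_real pi * \<i> * of_nat j / of_nat N
      = of_nat j * (2 * complex_of_real pi * \<i> / of_nat N)" by simp
  thus ?thesis unfolding zeta_def exp_of_nat_mult[symmetric] by (simp only:)
qed

lemma zeta_power_eq_iff: "N > 0 \<Longrightarrow> zeta N ^ j = zeta N ^ k \<longleftrightarrow> j mod N = k mod N"
  unfolding zeta_power using complex_root_unity_eq[of N j k] by simp

lemma zeta_power_N: "N > 0 \<Longrightarrow> zeta N ^ N = 1"
  using zeta_power_eq_iff[of N N 0] by simp

definition Phi :: "nat \<Rightarrow> int poly" where "Phi N = (\<Sum>i<N. monom 1 i)"

lemma coeff_Phi: "coeff (Phi N) i = (if i < N then 1 else 0)"
  by (simp add: Phi_def coeff_sum)

lemma degree_Phi: "N > 0 \<Longrightarrow> degree (Phi N) = N - 1"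
  by (rule antisym[OF degree_le le_degree]) (auto simp: coeff_Phi)

lemma ev_Phi: "(z - 1) * ev (Phi N) z = z ^ N - 1"
proof -
  have "ev (Phi N) z = (\<Sum>i<N. z ^ i)"
    by (simp add: Phi_def ev_sum ev_monom)
  thus ?thesis by (simp add: power_diff_1_eq)
qed

lemma ev_Phi_zeta: assumes "prime N" "\<not> N dvd j" shows "ev (Phi N) (zeta N ^ j) = 0"
proof -
  have N: "N > 0" using assms prime_gt_0_nat by blast
  have "zeta N ^ j \<noteq> 1" using zeta_power_eq_iff[OF N, of j 0] assms by (auto simp: mod_eq_0_iff_dvd)
  moreover have "(zeta N ^ j) ^ N = 1"
    by (metis N mult.commute power_mult power_one zeta_power_N)
  ultimately show ?thesis using ev_Phi[of "zeta N ^ j" N] by simp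
qed

lemma pcompose_power': "pcompose (p ^ n) r = pcompose p r ^ n" for p :: "int poly"
  by (induction n) (simp_all add: pcompose_1 pcompose_mult)

lemma coeff_Phi_shift:
  assumes "N > 0" shows "coeff (pcompose (Phi N) [:1, 1:]) i = int (N choose Suc i)"
proof -
  have "monom 1 1 * pcompose (Phi N) [:1,1:] = [:1,1:] ^ N - (1 :: int poly)"
  proof -
    have "Phi N = (\<Sum>i<N. [:0,1:] ^ i)" by (simp add: Phi_def monom_altdef)
    hence "[:-1,1:] * Phi N = [:0,1:] ^ N - 1"
      using power_diff_1_eq[of "[:0,1::int:]" N] by (simp add: one_pCons)
    hence "pcompose ([:-1,1:] * Phi N) [:1,1:] = pcompose ([:0,1:] ^ N - 1) [:1,1:]" by simp
    thus ?thesis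
      by (simp add: pcompose_mult pcompose_diff pcompose_power' pcompose_pCons monom_altdef pcompose_1 del: mult_pCons_left)
  qed
  hence "coeff (monom 1 1 * pcompose (Phi N) [:1,1:]) (Suc i) = coeff ([:1,1:] ^ N - (1 :: int poly)) (Suc i)"
    by simp
  thus ?thesis 
    by (cases "Suc i \<le> N")
       (simp_all add: coeff_monom_mult coeff_linear_poly_power coeff_eq_0 degree_linear_power)
qed


lemma Phi_factor:
  assumes p: "prime N" and PQ: "Phi N = P * Q" shows "degree P = 0 \<or> degree Q = 0"
proof (rule ccontr)
  assume "\<not> ?thesis"
  hence deg: "degree P > 0" "degree Q > 0" by auto
  have N: "N > 0" using p prime_gt_0_nat by blast
  have pi: "prime (int N)" using p by simp
  define A B where "A = pcompose P [:1,1:]" and "B = pcompose Q [:1,1:]"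
  have dA: "degree A = degree P" and dB: "degree B = degree Q"
    by (simp_all add: A_def B_def degree_pcompose)
  have AB: "coeff (A * B) i = int (N choose Suc i)" for i
    using coeff_Phi_shift[OF N, of i] by (simp add: PQ A_def B_def pcompose_mult)
  have P0: "P \<noteq> 0" "Q \<noteq> 0" using deg by auto
  have dsum: "degree A + degree B = N - 1"
    using degree_Phi[OF N] P0 by (simp add: PQ dA dB degree_mult_eq)
  have lc: "lead_coeff A * lead_coeff B = 1"
    using AB[of "N - 1"] N by (simp add: coeff_mult_degree_sum flip: dsum)
       (metis AB N One_nat_def Suc_pred binomial_n_n coeff_mult_degree_sum dsum of_nat_1)
  have nd: "\<not> int N dvd 1" using pi by (meson not_prime_unit)
  have lA: "\<not> int N dvd lead_coeff A" and lB: "\<not> int N dvd lead_coeff B"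
    using lc nd by (metis dvd_mult2, metis dvd_mult)
  define a b where "a = (LEAST i. \<not> int N dvd coeff A i)" and "b = (LEAST i. \<not> int N dvd coeff B i)"
  have a: "\<not> int N dvd coeff A a" "a \<le> degree A" "\<And>i. i < a \<Longrightarrow> int N dvd coeff A i"
    unfolding a_def using lA by (rule LeastI, rule Least_le, metis not_less_Least)
  have b: "\<not> int N dvd coeff B b" "b \<le> degree B" "\<And>i. i < b \<Longrightarrow> int N dvd coeff B i"
    unfolding b_def using lB by (rule LeastI, rule Least_le, metis not_less_Least)
  have "coeff (A * B) (a + b) = coeff A a * coeff B b + (\<Sum>i\<in>{..a+b}-{a}. coeff A i * coeff B (a + b - i))"
    unfolding coeff_mult by (subst sum.remove[of _ a]) auto
  moreover have "int N dvd (\<Sum>i\<in>{..a+b}-{a}. coeff A i * coeff B (a + b - i))"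
  proof (rule dvd_sum)
    fix i assume "i \<in> {..a+b}-{a}"
    hence "i < a \<or> a + b - i < b" by auto
    thus "int N dvd coeff A i * coeff B (a + b - i)" using a(3) b(3) by auto
  qed
  moreover have "\<not> int N dvd coeff A a * coeff B b"
    using a(1) b(1) pi by (simp add: prime_dvd_mult_iff)
  ultimately have ndv: "\<not> int N dvd int (N choose Suc (a + b))"
    by (simp add: AB dvd_add_left_iff)
  have "a + b \<ge> N - 1"
  proof (rule ccontr)
    assume "\<not> ?thesis"
    hence lt: "Suc (a + b) < N" by auto
    have "Suc (a + b) * (N choose Suc (a + b)) = N * ((N - 1) choose (a + b))"
      by (rule binomial_absorption)
    hence "N dvd Suc (a + b) * (N choose Suc (a + b))" by simp
    moreover have "\<not> N dvd Suc (a + b)" using lt by (auto dest: dvd_imp_le)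
    ultimately have "N dvd (N choose Suc (a + b))" using p prime_dvd_mult_iff by blast
    thus False using ndv by simp
  qed
  hence "a = degree A" "b = degree B" using a(2) b(2) dsum by auto
  hence "int N dvd coeff A 0" "int N dvd coeff B 0" using a(3) b(3) deg dA dB by auto
  hence "int N * int N dvd coeff A 0 * coeff B 0" by (rule mult_dvd_mono)
  also have "coeff A 0 * coeff B 0 = int N" using AB[of 0] by (simp add: coeff_mult)
  finally have "N * N dvd N * 1" by (simp flip: of_nat_mult)
  hence "N dvd 1" using N by (simp only: nat_mult_dvd_cancel_disj) auto
  thus False using p by simp
qed

lemma Phi_nz: "N > 0 \<Longrightarrow> Phi N \<noteq> 0"
  using coeff_Phi[of N 0] by auto

lemma content_Phi: "N > 0 \<Longrightarrow> content (Phi N) = 1"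
proof -
  assume "N > 0"
  hence "content (Phi N) dvd 1" using content_dvd_coeff[of "Phi N" 0] by (simp add: coeff_Phi)
  thus ?thesis by (metis is_unit_normalize normalize_content)
qed

lemma zeta_degree:
  assumes p: "prime N" and f: "f \<noteq> 0" "ev f (zeta N) = 0" shows "degree f \<ge> N - 1"
proof (rule ccontr)
  assume low: "\<not> ?thesis"
  have N: "N > 1" using p prime_gt_1_nat by blast
  obtain g where g: "g \<noteq> 0" "ev g (zeta N) = 0"
    and gmin: "\<And>h. h \<noteq> 0 \<Longrightarrow> ev h (zeta N) = 0 \<Longrightarrow> degree g \<le> degree h"
    using ex_has_least_nat[of "\<lambda>h. h \<noteq> 0 \<and> ev h (zeta N) = 0" f degree] f by auto
  have glow: "degree g < N - 1" using gmin[OF f] low by simp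
  have gpos: "degree g > 0"
  proof (rule ccontr)
    assume "\<not> ?thesis"
    then obtain c where "g = [:c:]" by (auto elim: degree_eq_zeroE)
    thus False using g by (simp add: ev_const)
  qed
  obtain a q where a: "a \<noteq> 0" "smult a (Phi N) = g * q + pseudo_mod (Phi N) g"
    using pseudo_mod(1)[OF g(1)] by blast
  have "ev (Phi N) (zeta N) = 0" using ev_Phi_zeta[OF p, of 1] N by simp
  hence "ev (pseudo_mod (Phi N) g) (zeta N) = 0"
    using arg_cong[OF a(2), of "\<lambda>h. ev h (zeta N)"] g(2) by (simp add: ev_add ev_mult ev_smult)
  hence "pseudo_mod (Phi N) g = 0" using pseudo_mod(2)[OF g(1), of "Phi N"] gmin by fastforce
  hence aq: "smult a (Phi N) = g * q" using a by simp
  have nz: "Phi N \<noteq> 0" using Phi_nz N by simp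
  have q0: "q \<noteq> 0" using aq nz a(1) by auto
  let ?P = "primitive_part g" and ?Q = "primitive_part q"
  have "\<bar>a\<bar> = content g * content q"
    using arg_cong[OF aq, of content] N by (simp add: content_mult content_Phi)
  moreover have "g * q = smult (content g * content q) (?P * ?Q)"
    by (metis content_times_primitive_part mult_smult_left mult_smult_right smult_smult)
  ultimately have "smult a (Phi N) = smult \<bar>a\<bar> (?P * ?Q)" using aq by simp
  also have "\<dots> = smult a (smult (sgn a) ?P * ?Q)" by (simp add: abs_sgn)
  finally have "Phi N = smult (sgn a) ?P * ?Q" using a(1) smult_cancel by blast
  hence "degree (smult (sgn a) ?P) = 0 \<or> degree ?Q = 0" by (rule Phi_factor[OF p])
  hence "degree g = 0 \<or> degree q = 0" using a(1) by (simp add: sgn_0_0)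
  moreover have "N - 1 = degree g + degree q"
    using arg_cong[OF aq, of degree] a(1) g(1) q0 N by (simp add: degree_mult_eq degree_Phi)
  ultimately show False using glow gpos by auto
qed

lemma Phi_div:
  assumes p: "prime N" shows "\<exists>q r. f = Phi N * q + r \<and> degree r < N - 1"
proof -
  have N: "N > 1" using p prime_gt_1_nat by blast
  obtain q r where qr: "pseudo_divmod f (Phi N) = (q, r)" by (cases "pseudo_divmod f (Phi N)")
  have "coeff (Phi N) (degree (Phi N)) = 1" using N by (simp add: degree_Phi coeff_Phi)
  with pseudo_divmod[OF Phi_nz qr] N have "f = Phi N * q + r" "degree r < N - 1"
    by (auto simp: degree_Phi)
  thus ?thesis by blast
qed

lemma ev_zeta_0_imp:
  assumes p: "prime N" and "ev f (zeta N) = 0" "\<not> N dvd j" shows "ev f (zeta N ^ j) = 0"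
proof -
  have N: "N > 1" using p prime_gt_1_nat by blast
  obtain q r where qr: "f = Phi N * q + r" "degree r < N - 1" using Phi_div[OF p] by blast
  have "ev (Phi N) (zeta N) = 0" using ev_Phi_zeta[OF p, of 1] N by simp
  hence "ev r (zeta N) = 0" using assms(2) by (simp add: qr(1) ev_add ev_mult)
  hence "r = 0" using zeta_degree[OF p, of r] qr(2) by auto
  thus ?thesis using ev_Phi_zeta[OF p assms(3)] by (simp add: qr(1) ev_mult)
qed

lemma is_cyc_coord_ex1:
  assumes p: "prime N" and "\<alpha> \<in> cyc_int N" shows "\<exists>!c. is_cyc_coord N \<alpha> c"
proof (rule ex_ex1I)
  have N: "N > 1" using p prime_gt_1_nat by blast
  obtain f where f: "\<alpha> = ev f (zeta N)" using assms(2) by (auto simp: cyc_int_def)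
  obtain q r where qr: "f * monom 1 (N - 1) = Phi N * q + r" "degree r < N - 1"
    using Phi_div[OF p] by blast
  have "ev (Phi N) (zeta N) = 0" using ev_Phi_zeta[OF p, of 1] N by simp
  hence "\<alpha> * zeta N ^ (N - 1) = ev r (zeta N)"
    using arg_cong[OF qr(1), of "\<lambda>h. ev h (zeta N)"] by (simp add: f ev_add ev_mult ev_monom)
  hence "\<alpha> * zeta N ^ (N - 1) * zeta N = zeta N * ev r (zeta N)" by simp
  hence "\<alpha> = zeta N * ev r (zeta N)"
    using zeta_power_N[of N] N by (simp add: mult.assoc flip: power_Suc2)
  also have "ev r (zeta N) = (\<Sum>i<N-1. of_int (coeff r i) * zeta N ^ i)"
    unfolding ev_altdef using qr(2) by (intro sum.mono_neutral_left) (auto simp: coeff_eq_0)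
  also have "zeta N * \<dots> = (\<Sum>i=1..N-1. of_int (coeff r (i - 1)) * zeta N ^ i)"
    unfolding sum_distrib_left
    by (rule sum.reindex_bij_witness[of _ "\<lambda>i. i - 1" Suc]) auto
  finally have "is_cyc_coord N \<alpha> (\<lambda>i. if i \<in> {1..N-1} then coeff r (i - 1) else 0)"
    by (simp add: is_cyc_coord_def)
  thus "\<exists>c. is_cyc_coord N \<alpha> c" by blast
next
  have N: "N > 1" using p prime_gt_1_nat by blast
  fix c d assume cd: "is_cyc_coord N \<alpha> c" "is_cyc_coord N \<alpha> d"
  define r where "r = (\<Sum>i<N-1. monom (c (Suc i) - d (Suc i)) i)"
  have cr: "coeff r i = (if i < N - 1 then c (Suc i) - d (Suc i) else 0)" for i
    by (simp add: r_def coeff_sum)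
  have "zeta N * ev r (zeta N) = (\<Sum>i<N-1. of_int (c (Suc i) - d (Suc i)) * zeta N ^ Suc i)"
    by (simp add: r_def ev_sum ev_monom sum_distrib_left algebra_simps)
  also have "\<dots> = (\<Sum>i=1..N-1. of_int (c i - d i) * zeta N ^ i)"
    by (rule sum.reindex_bij_witness[of _ "\<lambda>i. i - 1" Suc]) auto
  also have "\<dots> = 0" using cd by (simp add: is_cyc_coord_def algebra_simps sum_subtractf)
  finally have "ev r (zeta N) = 0" by (simp add: zeta_def)
  moreover have "degree r < N - 1"
    using N degree_le[of "N - 2" r] by (force simp: cr)
  ultimately have "r = 0" using zeta_degree[OF p, of r] by auto
  show "c = d"
  proof
    fix i show "c i = d i"
    proof (cases "i \<in> {1..N-1}")
      case True
      thus ?thesis using cr[of "i - 1"] \<open>r = 0\<close> by (cases i) (auto split: if_splits)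
    qed (use cd in \<open>auto simp: is_cyc_coord_def\<close>)
  qed
qed

lemma is_cyc_sigma_ev:
  assumes "is_cyc_sigma N j \<sigma>" shows "\<sigma> (ev f (zeta N)) = ev f (zeta N ^ j)"
proof -
  have h: "\<sigma> (x * y) = \<sigma> x * \<sigma> y" "\<sigma> (x + y) = \<sigma> x + \<sigma> y" "\<sigma> 1 = 1"
    if "x \<in> cyc_int N" "y \<in> cyc_int N" for x y
    using assms that by (auto simp: is_cyc_sigma_def ring_iso_def ring_hom_def cyc_ring_def)
  have mem: "ev g (zeta N) \<in> cyc_int N" for g by (auto simp: cyc_int_def)
  have int0: "\<sigma> 0 = 0" using h(2)[of 0 0] mem[of 0] by simp
  have natc: "\<sigma> (of_nat n) = of_nat n" for n
  proof (induction n)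
    case (Suc n)
    have "of_nat n \<in> cyc_int N" "1 \<in> cyc_int N" using mem[of "[:int n:]"] mem[of 1] by (simp_all add: ev_const ev_1)
    thus ?case using h(2)[of 1 "of_nat n"] h(3) Suc by simp
  qed (simp add: int0)
  have intc: "\<sigma> (of_int n) = of_int n" for n
  proof (cases n)
    case (neg m)
    have "of_int n \<in> cyc_int N" "of_nat (Suc m) \<in> cyc_int N" using mem[of "[:n:]"] mem[of "[:int (Suc m):]"] by (simp_all only: ev_const of_int_of_nat_eq)
    hence "\<sigma> (of_int n + of_nat (Suc m)) = \<sigma> (of_int n) + of_nat (Suc m)" using h(2) natc by metis
    moreover have "(of_int n :: complex) + of_nat (Suc m) = 0" using neg by simp
    ultimately show ?thesis using int0 by (metis add_right_cancel)
  qed (simp add: natc)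
  show ?thesis
  proof (induction f)
    case 0 show ?case by (simp add: int0)
  next
    case (pCons a f)
    have z: "zeta N \<in> cyc_int N" using mem[of "monom 1 1"] by (simp add: ev_monom)
    have "zeta N * ev f (zeta N) \<in> cyc_int N" using mem[of "monom 1 1 * f"] by (simp add: ev_mult ev_monom)
    moreover have "of_int a \<in> cyc_int N" using mem[of "[:a:]"] by (simp add: ev_const)
    ultimately show ?case using pCons assms z mem[of f]
      by (simp add: map_poly_pCons h intc is_cyc_sigma_def)
  qed
qed

lemma is_cyc_sigma_ex1:
  assumes p: "prime N" and j: "j \<in> {1..N-1}" shows "\<exists>!\<sigma>. is_cyc_sigma N j \<sigma>"
proof (rule ex_ex1I)
  have N: "N > 1" using p prime_gt_1_nat by blast
  have jN: "\<not> N dvd j" using j by (auto dest: dvd_imp_le)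
  define s where "s = (\<lambda>x\<in>cyc_int N. ev (SOME f. x = ev f (zeta N)) (zeta N ^ j))"
  have mem: "ev g (zeta N) \<in> cyc_int N" for g by (auto simp: cyc_int_def)
  have s: "s (ev f (zeta N)) = ev f (zeta N ^ j)" for f
  proof -
    define g where "g = (SOME g. ev f (zeta N) = ev g (zeta N))"
    have "ev f (zeta N) = ev g (zeta N)" unfolding g_def by (rule someI[of _ f]) simp
    hence "ev (f - g) (zeta N ^ j) = 0" by (intro ev_zeta_0_imp[OF p _ jN]) (simp add: ev_diff)
    thus ?thesis using mem by (simp add: s_def g_def ev_diff)
  qed
  have pw: "ev f (zeta N ^ k) = ev (pcompose f (monom 1 k)) (zeta N)" for f k
    by (simp add: ev_pcompose ev_monom)
  have "coprime j N" using jN p by (metis coprime_commute prime_imp_coprime)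
  then obtain k where "[j * k = Suc 0] (mod N)"
    using cong_solve_coprime_nat by blast
  hence k: "(j * k) mod N = 1" using N by (simp add: cong_def)
  have kN: "\<not> N dvd k" 
  proof
    assume "N dvd k"
    hence "(j * k) mod N = 0" by simp
    thus False using k by simp
  qed
  have zjk: "zeta N ^ (j * k) = zeta N"
    using zeta_power_eq_iff[of N "j * k" 1] k N by simp
  have inj: "inj_on s (cyc_int N)"
  proof (rule inj_onI)
    fix x y assume "x \<in> cyc_int N" "y \<in> cyc_int N" and e: "s x = s y"
    then obtain f g where fg: "x = ev f (zeta N)" "y = ev g (zeta N)" by (auto simp: cyc_int_def)
    hence "ev (f - g) (zeta N ^ j) = 0" using e s by (simp add: ev_diff)
    hence "ev (pcompose (f - g) (monom 1 j)) (zeta N) = 0" by (simp only: pw)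
    hence "ev (pcompose (f - g) (monom 1 j)) (zeta N ^ k) = 0" by (rule ev_zeta_0_imp[OF p _ kN])
    hence "ev (f - g) (zeta N) = 0"
      using zjk by (simp add: ev_pcompose ev_monom mult.commute flip: power_mult)
    thus "x = y" using fg by (simp add: ev_diff)
  qed
  moreover have "s ` cyc_int N = cyc_int N"
  proof
    show "s ` cyc_int N \<subseteq> cyc_int N" using s pw mem by (auto simp: cyc_int_def)
    show "cyc_int N \<subseteq> s ` cyc_int N"
    proof
      fix x assume "x \<in> cyc_int N"
      then obtain f where f: "x = ev f (zeta N)" by (auto simp: cyc_int_def)
      have "s (ev (pcompose f (monom 1 k)) (zeta N)) = x"
        unfolding s using zjk by (simp add: f ev_pcompose ev_monom flip: power_mult)
      thus "x \<in> s ` cyc_int N" using mem by (metis imageI)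
    qed
  qed
  ultimately have bij: "bij_betw s (cyc_int N) (cyc_int N)" by (simp add: bij_betw_def)
  have hom: "s (x * y) = s x * s y \<and> s (x + y) = s x + s y"
    if xy: "x \<in> cyc_int N" "y \<in> cyc_int N" for x y
  proof -
    obtain f g where fg: "x = ev f (zeta N)" "y = ev g (zeta N)" using xy by (auto simp: cyc_int_def)
    show ?thesis unfolding fg using s[of "f * g"] s[of "f + g"] s[of f] s[of g]
      by (simp add: ev_add ev_mult)
  qed
  have "s 1 = 1" using s[of 1] by (simp add: ev_1)
  moreover have "s (zeta N) = zeta N ^ j" using s[of "monom 1 1"] by (simp add: ev_monom)
  moreover have "s \<in> cyc_int N \<rightarrow> cyc_int N" using bij bij_betwE by blast
  moreover have "s \<in> extensional (cyc_int N)" by (simp add: s_def)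
  ultimately have "is_cyc_sigma N j s"
    using bij hom by (auto simp: is_cyc_sigma_def ring_iso_def ring_hom_def cyc_ring_def)
  thus "\<exists>\<sigma>. is_cyc_sigma N j \<sigma>" by blast
next
  fix s t assume st: "is_cyc_sigma N j s" "is_cyc_sigma N j t"
  show "s = t"
  proof (rule extensionalityI)
    show "s \<in> extensional (cyc_int N)" "t \<in> extensional (cyc_int N)" using st by (auto simp: is_cyc_sigma_def)
    fix x assume "x \<in> cyc_int N"
    thus "s x = t x" using st by (auto simp: cyc_int_def is_cyc_sigma_ev)
  qed
qed

lemma of_int_cyc_norm:
  assumes p: "prime N" and \<alpha>: "\<alpha> \<in> cyc_int N"
  shows "of_int (cyc_norm N \<alpha>) = (\<Prod>j=1..N-1. cyc_sigma N j \<alpha>)"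
proof -
  have N: "N > 1" using p prime_gt_1_nat by blast
  obtain f where f: "\<alpha> = ev f (zeta N)" using \<alpha> by (auto simp: cyc_int_def)
  let ?P = "\<Prod>j=1..N-1. cyc_sigma N j \<alpha>"
  have P: "?P = (\<Prod>j=1..N-1. ev f (zeta N ^ j))"
    by (intro prod.cong refl)
       (metis f is_cyc_sigma_ev cyc_sigma_def is_cyc_sigma_ex1[OF p] theI')
  define F where "F = (\<Prod>j=1..N-1. pcompose f (monom 1 j))"
  have F: "ev F (zeta N ^ k) = ?P" if k: "k \<in> {1..N-1}" for k
  proof -
    have kN: "\<not> N dvd k" using k by (auto dest: dvd_imp_le)
    have "ev F (zeta N ^ k) = (\<Prod>j=1..N-1. ev f (zeta N ^ ((k * j) mod N)))"
      using zeta_power_eq_iff[of N] N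
      by (simp add: F_def ev_prod ev_pcompose ev_monom flip: power_mult)
         (intro prod.cong refl arg_cong[where f = "ev f"], simp)
    also have "\<dots> = (\<Prod>j\<in>(\<lambda>j. (k * j) mod N) ` {1..N-1}. ev f (zeta N ^ j))"
    proof (subst prod.reindex)
      show "inj_on (\<lambda>j. (k * j) mod N) {1..N-1}"
      proof (rule inj_onI)
        fix x y assume xy: "x \<in> {1..N-1}" "y \<in> {1..N-1}" "k * x mod N = k * y mod N"
        have "coprime k N" using kN p by (metis coprime_commute prime_imp_coprime)
        hence "[x = y] (mod N)" using xy(3) by (metis cong_def cong_mult_lcancel_nat)
        thus "x = y" using xy N by (auto simp: cong_def)
      qed
    qed (simp add: o_def)
    also have "(\<lambda>j. (k * j) mod N) ` {1..N-1} = {1..N-1}"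
    proof (rule card_subset_eq)
      show "(\<lambda>j. (k * j) mod N) ` {1..N-1} \<subseteq> {1..N-1}"
      proof safe
        fix j assume "j \<in> {1..N-1}"
        hence "\<not> N dvd j" by (auto dest: dvd_imp_le)
        hence "\<not> N dvd k * j" using kN p prime_dvd_mult_iff by blast
        hence "k * j mod N \<noteq> 0" by (metis dvd_eq_mod_eq_0)
        moreover have "k * j mod N < N" using N by simp
        ultimately show "k * j mod N \<in> {1..N-1}" by auto
      qed
      show "card ((\<lambda>j. (k * j) mod N) ` {1..N-1}) = card {1..N-1}"
      proof (rule card_image, rule inj_onI)
        fix x y assume xy: "x \<in> {1..N-1}" "y \<in> {1..N-1}" "k * x mod N = k * y mod N"
        have "coprime k N" using kN p by (metis coprime_commute prime_imp_coprime)
        hence "[x = y] (mod N)" using xy(3) by (metis cong_def cong_mult_lcancel_nat)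
        thus "x = y" using xy N by (auto simp: cong_def)
      qed
    qed simp
    finally show ?thesis by (simp only: P)
  qed
  obtain q r where qr: "F = Phi N * q + r" "degree r < N - 1" using Phi_div[OF p] by blast
  define R where "R = map_poly of_int r - [:?P:]"
  have Rz: "poly R (zeta N ^ k) = 0" if k: "k \<in> {1..N-1}" for k
  proof -
    have "\<not> N dvd k" using k by (auto dest: dvd_imp_le)
    thus ?thesis using F[OF k] ev_Phi_zeta[OF p] by (simp add: R_def qr(1) ev_add ev_mult)
  qed
  have "R = 0"
  proof (rule ccontr)
    assume R0: "R \<noteq> 0"
    have "card ((\<lambda>k. zeta N ^ k) ` {1..N-1}) \<le> card {x. poly R x = 0}"
      using Rz poly_roots_finite[OF R0] by (intro card_mono) auto
    also have "\<dots> \<le> degree R" by (rule card_poly_roots_bound[OF R0])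
    also have "\<dots> \<le> degree r"
      unfolding R_def by (rule degree_diff_le) (simp_all add: degree_map_poly)
    also have "\<dots> < N - 1" by (rule qr)
    also have "card ((\<lambda>k. zeta N ^ k) ` {1..N-1}) = N - 1"
      using zeta_power_eq_iff[of N] N by (subst card_image) (auto intro!: inj_onI)
    finally show False by simp
  qed
  hence "coeff R 0 = 0" by simp
  hence "of_int (coeff r 0) = ?P" by (simp add: R_def coeff_map_poly)
  thus ?thesis unfolding cyc_norm_def
    by (metis (mono_tags, lifting) of_int_eq_iff the_equality)
qed

end

theory Submission
  imports Defs
begin

text \<open>
  Let \<open>m\<close> be the number of nonzero coordinates of \<open>\<beta>\<close>. Parseval's identity on \<open>\<int>/N\<int>\<close> gives
  \<open>\<Sum>|\<sigma>\<^sub>j(\<beta>)|\<^sup>2 = m (N - m)\<close>, summed over \<open>1 \<le> j < N\<close>, and this is at most \<open>(N - 1) (N + 1) / 4\<close>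
  because \<open>N\<close> is odd. The AM-GM inequality then bounds the product of the \<open>|\<sigma>\<^sub>j(\<beta>)|\<^sup>2\<close>, which is
  the square of the norm. Equality forces \<open>|\<beta>|\<^sup>2 = (N + 1) / 4\<close>; this is an integer since one of
  its powers is the norm.
\<close>

lemma cyc_sigma_ev:
  assumes "prime N" "j \<in> {1..N-1}"
  shows "cyc_sigma N j (ev f (zeta N)) = ev f (zeta N ^ j)"
proof -
  have "is_cyc_sigma N j (cyc_sigma N j)"
    unfolding cyc_sigma_def by (rule theI'[OF is_cyc_sigma_ex1[OF assms]])
  thus ?thesis by (rule is_cyc_sigma_ev)
qed

lemma cyc_coord_correct:
  assumes "prime N" "\<alpha> \<in> cyc_int N"
  shows "is_cyc_coord N \<alpha> (cyc_coord N \<alpha>)"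
  unfolding cyc_coord_def by (rule theI'[OF is_cyc_coord_ex1[OF assms]])

text \<open>Since \<open>c 0 = 0\<close>, the sum may start at 0. The conjugates are thus values of
  the discrete Fourier transform of \<open>c\<close> on all residues modulo \<open>N\<close>, the
  form that \<open>zeta_parseval\<close> handles.\<close>

lemma cyc_sigma_coord:
  assumes "prime N" "j \<in> {1..N-1}" "is_cyc_coord N \<alpha> c"
  shows "cyc_sigma N j \<alpha> = (\<Sum>i<N. of_int (c i) * zeta N ^ (i * j))"
proof -
  let ?f = "\<Sum>i=1..N-1. monom (c i) i"
  have "\<alpha> = ev ?f (zeta N)"
    using assms(3) by (simp add: is_cyc_coord_def ev_sum ev_monom)
  hence "cyc_sigma N j \<alpha> = (\<Sum>i=1..N-1. of_int (c i) * zeta N ^ (i * j))"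
    using cyc_sigma_ev[OF assms(1,2), of ?f]
    by (simp add: ev_sum ev_monom mult.commute flip: power_mult)
  also have "\<dots> = (\<Sum>i<N. of_int (c i) * zeta N ^ (i * j))"
    using assms(2,3) by (intro sum.mono_neutral_left) (auto simp: is_cyc_coord_def)
  finally show ?thesis .
qed

lemma cyc_sigma_1:
  assumes "prime N" "\<alpha> \<in> cyc_int N"
  shows "cyc_sigma N 1 \<alpha> = \<alpha>"
proof -
  have "1 \<in> {1..N-1}" using prime_gt_1_nat[OF assms(1)] by auto
  thus ?thesis using assms cyc_sigma_ev[OF assms(1), of 1] by (auto simp: cyc_int_def)
qed

lemma zeta_cnj_mult: "zeta N * cnj (zeta N) = 1"
proof -
  have "norm (zeta N) = 1" by (simp add: zeta_def norm_exp_eq_Re Re_divide_of_nat)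
  thus ?thesis using complex_norm_square[of "zeta N"] by simp
qed

text \<open>Conjugation inverts \<open>zeta N\<close>, so the sum is a geometric series in the root
  of unity \<open>w\<close>. For distinct residues \<open>w\<close> differs from 1 while
  \<open>w ^ N = 1\<close>, and the series vanishes.\<close>

lemma zeta_orthogonal:
  assumes "i < N" "k < N"
  shows "(\<Sum>j<N. zeta N ^ (i * j) * cnj (zeta N ^ (k * j))) = (if i = k then of_nat N else 0)"
proof -
  define w where "w = zeta N ^ i * cnj (zeta N ^ k)"
  have zk: "zeta N ^ k * cnj (zeta N ^ k) = 1" for k
    using zeta_cnj_mult[of N] by (simp flip: power_mult_distrib)
  have sum_w: "(\<Sum>j<N. zeta N ^ (i * j) * cnj (zeta N ^ (k * j))) = (\<Sum>j<N. w ^ j)"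
    by (simp add: w_def power_mult power_mult_distrib)
  show ?thesis
  proof (cases "i = k")
    case True
    thus ?thesis using zk by (simp add: sum_w w_def)
  next
    case False
    have "w \<noteq> 1"
    proof
      assume "w = 1"
      hence "w * zeta N ^ k = zeta N ^ k" by simp
      moreover have "w * zeta N ^ k = zeta N ^ i * (zeta N ^ k * cnj (zeta N ^ k))"
        by (simp add: w_def)
      ultimately have "zeta N ^ i = zeta N ^ k" by (simp only: zk mult_1_right)
      thus False using zeta_power_eq_iff[of N i k] assms False by simp
    qed
    moreover have "w ^ N = 1"
    proof -
      have zN: "(zeta N ^ l) ^ N = 1" for l
        using zeta_power_N[of N] assms by (simp add: power_commuting_commutes power_mult[symmetric] mult.commute[of l])
          (simp add: power_mult)
      have "w ^ N = (zeta N ^ i) ^ N * cnj ((zeta N ^ k) ^ N)"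
        by (simp only: w_def power_mult_distrib complex_cnj_power)
      thus ?thesis by (simp only: zN) simp
    qed
    ultimately show ?thesis unfolding sum_w using False power_diff_1_eq[of w N] by simp
  qed
qed

text \<open>Write each squared modulus as a double sum over \<open>i\<close> and \<open>k\<close>
  and sum over \<open>j\<close> first: by orthogonality only the diagonal \<open>i = k\<close>
  survives, each term with weight \<open>N\<close>.\<close>

lemma zeta_parseval:
  fixes c :: "nat \<Rightarrow> int"
  shows "(\<Sum>j<N. (cmod (\<Sum>i<N. of_int (c i) * zeta N ^ (i * j)))\<^sup>2) = real N * (\<Sum>i<N. (of_int (c i))\<^sup>2)"
proof -
  have "complex_of_real (\<Sum>j<N. (cmod (\<Sum>i<N. of_int (c i) * zeta N ^ (i * j)))\<^sup>2)
      = (\<Sum>j<N. \<Sum>i<N. \<Sum>k<N. of_int (c i) * of_int (c k) * (zeta N ^ (i * j) * cnj (zeta N ^ (k * j))))"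
    unfolding of_real_sum complex_norm_square
    by (intro sum.cong refl) (simp add: sum_product algebra_simps)
  also have "\<dots> = (\<Sum>i<N. \<Sum>j<N. \<Sum>k<N. of_int (c i) * of_int (c k) * (zeta N ^ (i * j) * cnj (zeta N ^ (k * j))))"
    by (rule sum.swap)
  also have "\<dots> = (\<Sum>i<N. \<Sum>k<N. \<Sum>j<N. of_int (c i) * of_int (c k) * (zeta N ^ (i * j) * cnj (zeta N ^ (k * j))))"
    by (intro sum.cong refl sum.swap)
  also have "\<dots> = (\<Sum>i<N. \<Sum>k<N. of_int (c i) * of_int (c k) * (if i = k then of_nat N else 0))"
    unfolding sum_distrib_left[symmetric] by (intro sum.cong refl) (simp only: zeta_orthogonal lessThan_iff)
  also have "\<dots> = (\<Sum>i<N. of_int (c i) * of_int (c i) * of_nat N)"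
    by (intro sum.cong refl) (simp add: if_distrib[of "\<lambda>x. _ * x"] cong: if_cong)
  also have "\<dots> = complex_of_real (real N * (\<Sum>i<N. (of_int (c i))\<^sup>2))"
    by (simp add: power2_eq_square sum_distrib_left mult.commute)
  finally show ?thesis unfolding of_real_eq_iff .
qed

text \<open>This is AM-GM normalised to mean at most 1. It follows by summing
  \<open>ln x \<le> x - 1\<close>, and equality there only at \<open>x = 1\<close> settles the
  equality case. A zero factor, for which the logarithm is of no use, makes the product 0.\<close>

lemma prod_le_1_if_sum_le_card:
  fixes a :: "'a \<Rightarrow> real"
  assumes fin: "finite A" and nonneg: "\<And>x. x \<in> A \<Longrightarrow> a x \<ge> 0" and le: "sum a A \<le> card A"
  shows "prod a A \<le> 1 \<and> (prod a A = 1 \<longrightarrow> (\<forall>x\<in>A. a x = 1))"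
proof (cases "\<exists>x\<in>A. a x = 0")
  case True
  hence "prod a A = 0" using fin by (simp add: prod_zero)
  thus ?thesis by simp
next
  case False
  hence pos: "a x > 0" if "x \<in> A" for x using nonneg[OF that] that by fastforce
  have ln: "ln (a x) \<le> a x - 1" if "x \<in> A" for x by (rule ln_le_minus_one[OF pos[OF that]])
  have ppos: "prod a A > 0" using pos by (simp add: prod_pos)
  have ln_prod: "ln (prod a A) = (\<Sum>x\<in>A. ln (a x))"
    using fin pos by (intro ln_prod) force+
  have sum_le: "(\<Sum>x\<in>A. a x - 1) \<le> 0" using le by (simp add: sum_subtractf)
  have "(\<Sum>x\<in>A. ln (a x)) \<le> (\<Sum>x\<in>A. a x - 1)" by (intro sum_mono ln)
  hence "ln (prod a A) \<le> 0" using sum_le ln_prod by linarith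
  hence "prod a A \<le> 1" using ppos by simp
  moreover have "a x = 1" if "prod a A = 1" "x \<in> A" for x
  proof -
    \<comment> \<open>The logarithms sum to 0, so the nonnegative gaps
      \<open>a x - 1 - ln (a x)\<close> have sum at most 0 and must vanish one by one.\<close>
    have "(\<Sum>x\<in>A. a x - 1 - ln (a x)) \<le> 0"
      using that(1) ln_prod sum_le by (simp add: sum_subtractf)
    moreover have "(\<Sum>x\<in>A. a x - 1 - ln (a x)) \<ge> 0" using ln by (intro sum_nonneg) simp
    ultimately have "(\<Sum>x\<in>A. a x - 1 - ln (a x)) = 0" by simp
    hence "a x - 1 - ln (a x) = 0"
      using fin ln that(2) by (subst (asm) sum_nonneg_eq_0_iff) auto
    thus "a x = 1" using ln_eq_minus_one[OF pos[OF that(2)]] by simp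
  qed
  ultimately show ?thesis by blast
qed

lemma sum_cmod_sigma_binary_le:
  assumes p: "prime N" and "odd N" and \<beta>: "cyc_binary N \<beta>"
  shows "(\<Sum>j=1..N-1. (cmod (cyc_sigma N j \<beta>))\<^sup>2) \<le> real (N - 1) * ((real N + 1) / 4)"
proof -
  have N: "N > 1" using p prime_gt_1_nat by blast
  define c where "c = cyc_coord N \<beta>"
  have coord: "is_cyc_coord N \<beta> c"
    using cyc_coord_correct[OF p] \<beta> by (simp add: c_def cyc_binary_def)
  hence c0: "c i = 0" if "i \<notin> {1..N-1}" for i using that by (simp add: is_cyc_coord_def)
  \<comment> \<open>\<open>s\<close> is the common sign of the nonzero coordinates, which treats
    both cases of \<open>cyc_binary\<close> at once: the sum of squares \<open>m\<close> is
    \<open>s\<close> times the coordinate sum.\<close>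
  obtain s :: int where s: "s\<^sup>2 = 1" "\<And>i. (c i)\<^sup>2 = s * c i"
  proof (cases "\<forall>i\<in>{1..N-1}. c i \<in> {0, 1}")
    case True
    hence "(c i)\<^sup>2 = 1 * c i" for i using c0[of i] by (cases "i \<in> {1..N-1}") (fastforce simp: power2_eq_square)+
    thus ?thesis using that[of 1] by simp
  next
    case False
    hence "\<forall>i\<in>{1..N-1}. c i \<in> {-1, 0}" using \<beta> by (auto simp: cyc_binary_def c_def)
    hence "(c i)\<^sup>2 = -1 * c i" for i using c0[of i] by (cases "i \<in> {1..N-1}") (fastforce simp: power2_eq_square)+
    thus ?thesis using that[of "-1"] by simp
  qed
  define m where "m = (\<Sum>i<N. (c i)\<^sup>2)"
  have "m = s * (\<Sum>i<N. c i)" by (simp add: m_def s(2) sum_distrib_left)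
  hence m2: "m\<^sup>2 = (\<Sum>i<N. c i)\<^sup>2" by (simp add: power_mult_distrib s(1))
  let ?g = "\<lambda>j. (cmod (\<Sum>i<N. of_int (c i) * zeta N ^ (i * j)))\<^sup>2"
  \<comment> \<open>Parseval also counts \<open>j = 0\<close>, which belongs to no automorphism. Its
    term is the squared coordinate sum; removing it leaves \<open>N * m - m^2\<close>.\<close>
  have "?g 0 = (of_int m)\<^sup>2"
  proof -
    have "?g 0 = (cmod (of_int (\<Sum>i<N. c i)))\<^sup>2" by simp
    also have "\<dots> = of_int ((\<Sum>i<N. c i)\<^sup>2)" by (simp only: norm_of_int of_int_power power2_abs)
    finally show ?thesis by (simp only: m2[symmetric] of_int_power)
  qed
  moreover have "(\<Sum>j<N. ?g j) = ?g 0 + (\<Sum>j=1..N-1. ?g j)"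
  proof -
    have "{..<N} = insert 0 {1..N-1}" using N by auto
    thus ?thesis by simp
  qed
  moreover have "(\<Sum>j<N. ?g j) = real N * of_int m" by (simp add: zeta_parseval m_def)
  moreover have "(\<Sum>j=1..N-1. ?g j) = (\<Sum>j=1..N-1. (cmod (cyc_sigma N j \<beta>))\<^sup>2)"
    by (intro sum.cong refl) (simp add: cyc_sigma_coord[OF p _ coord])
  ultimately have eq: "(\<Sum>j=1..N-1. (cmod (cyc_sigma N j \<beta>))\<^sup>2) = of_int (m * (int N - m))"
    by (simp add: algebra_simps power2_eq_square)
  \<comment> \<open>Parity gains the 1 here: a nonzero integer square is at least 1. Expanding gives
    \<open>4 * m * (N - m) \<le> N^2 - 1\<close>.\<close>
  have "(int N - 2 * m)\<^sup>2 \<ge> 1"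
  proof -
    have "odd (int N - 2 * m)" using \<open>odd N\<close> by simp
    hence "int N - 2 * m \<noteq> 0" by fastforce
    hence "(int N - 2 * m)\<^sup>2 > 0" by simp
    thus ?thesis by linarith
  qed
  hence "4 * (m * (int N - m)) \<le> (int N - 1) * (int N + 1)"
    by (simp add: power2_eq_square algebra_simps)
  hence "real_of_int (4 * (m * (int N - m))) \<le> real_of_int ((int N - 1) * (int N + 1))"
    by (simp only: of_int_le_iff)
  thus ?thesis using N unfolding eq by (simp add: of_nat_diff)
qed

theorem theorem2:
  fixes N :: nat and \<beta> :: complex
  assumes "prime N" and "odd N"
    and "cyc_binary N \<beta>"
  shows "real_of_int (cyc_norm N \<beta>) \<le> ((real N + 1) / 4) ^ ((N - 1) div 2) \<and>
    (real_of_int (cyc_norm N \<beta>) = ((real N + 1) / 4) ^ ((N - 1) div 2) \<longrightarrow> cyc_perfect N \<beta>)"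
proof -
  define k where "k = (N - 1) div 2"
  define b where "b = (real N + 1) / 4"
  have N: "N > 1" using assms(1) prime_gt_1_nat by blast
  have N2: "N - 1 = 2 * k" using \<open>odd N\<close> by (auto simp: k_def elim: oddE)
  have k: "k > 0" using N N2 by simp
  have b: "b > 0" by (simp add: b_def)
  have mem: "\<beta> \<in> cyc_int N" using assms(3) by (simp add: cyc_binary_def)
  define n where "n = real_of_int (cyc_norm N \<beta>)"
  \<comment> \<open>Dividing by \<open>b\<close> brings the mean of the squared moduli down to at
    most 1, as the normalised AM-GM requires.\<close>
  define a where "a = (\<lambda>j. (cmod (cyc_sigma N j \<beta>))\<^sup>2 / b)"
  have "complex_of_real n = (\<Prod>j=1..N-1. cyc_sigma N j \<beta>)"
    using of_int_cyc_norm[OF assms(1) mem] by (simp add: n_def)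
  hence "\<bar>n\<bar> = (\<Prod>j=1..N-1. cmod (cyc_sigma N j \<beta>))" by (metis norm_of_real prod_norm)
  hence "n\<^sup>2 = (\<Prod>j=1..N-1. (cmod (cyc_sigma N j \<beta>))\<^sup>2)"
    by (metis power2_abs prod_power_distrib)
  hence prod_a: "prod a {1..N-1} = n\<^sup>2 / (b ^ k)\<^sup>2"
    unfolding a_def prod_dividef by (simp add: N2 mult.commute del: One_nat_def flip: power_mult)
  have "sum a {1..N-1} \<le> real (N - 1)"
    using sum_cmod_sigma_binary_le[OF assms] b
    unfolding a_def sum_divide_distrib[symmetric] b_def[symmetric] by (simp add: divide_le_eq)
  hence amgm: "prod a {1..N-1} \<le> 1" "prod a {1..N-1} = 1 \<longrightarrow> (\<forall>j\<in>{1..N-1}. a j = 1)"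
    using prod_le_1_if_sum_le_card[of "{1..N-1}" a] b by (auto simp: a_def)
  have "n\<^sup>2 \<le> (b ^ k)\<^sup>2" using amgm(1) b unfolding prod_a by simp
  hence "n \<le> b ^ k" by (rule power2_le_imp_le) (use b in simp)
  moreover have "cyc_perfect N \<beta>" if "n = b ^ k"
  proof -
    have "prod a {1..N-1} = 1" unfolding prod_a using that b by simp
    \<comment> \<open>Index 1 suffices: the first automorphism is the identity, so this gives the
      squared modulus of \<beta> itself.\<close>
    hence "a 1 = 1" using amgm(2) N by auto
    hence sq: "(cmod \<beta>)\<^sup>2 = b"
      using b by (simp add: a_def cyc_sigma_1[OF assms(1) mem, unfolded One_nat_def])
    \<comment> \<open>It remains to see that \<open>b\<close> is an integer. Clearing denominators
      in \<open>n = b ^ k\<close> gives a divisibility between \<open>k\<close>-th powers, which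
      descends to \<open>4 dvd int N + 1\<close> because \<open>k > 0\<close>.\<close>
    have "real_of_int (cyc_norm N \<beta> * 4 ^ k) = real_of_int ((int N + 1) ^ k)"
      using that by (simp add: n_def b_def power_divide)
    hence "cyc_norm N \<beta> * 4 ^ k = (int N + 1) ^ k" by (simp only: of_int_eq_iff)
    hence "4 ^ k dvd (int N + 1) ^ k" by (metis dvd_triv_right)
    hence "4 dvd int N + 1" using k by (simp add: pow_divides_pow_iff)
    then obtain l where "int N + 1 = 4 * l" by blast
    hence "real_of_int (int N + 1) = real_of_int (4 * l)" by (simp only:)
    hence "b = of_int l" by (simp add: b_def)
    hence "\<beta> * cnj \<beta> = of_int l" using sq by (metis complex_norm_square of_real_of_int_eq)
    thus ?thesis using assms(3) by (simp add: cyc_perfect_def)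
  qed
  ultimately show ?thesis unfolding n_def b_def k_def by blast
qed

end
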